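(* Let $K$ be a field of characteristic $0$, let $E$ be the infinite-dimensional unitary Grassmann algebra over $K$ with even part $E_0$, let $A=\begin{pmatrix} E_0 & E\\ 0 & E\end{pmatrix}$, and let $F_n(A)=K\langle x_1,\dots,x_n\rangle/(K\langle x_1,\dots,x_n\rangle\cap T(A))$. For $n\geq1$ let $E^{(n)}$ be the finite-dimensional unitary Grassmann algebra generated by $e_1,\dots,e_n$, with even part $E^{(n)}_0$, and let \[A^{(n)}=\begin{pmatrix} E^{(n)}_0 & E^{(n)}\\ 0 & E^{(n)}\end{pmatrix}.\] If $n\geq 2$ is even, then $F_n(A)$ and $A^{(n)}$ satisfy the same polynomial identities, i.e. $T(F_n(A))=T(A^{(n)})$.
   Context: All algebras are associative and unitary over $K$; $T(R)$ is the ideal of polynomial identities of $R$ in the free unitary algebra $K\langle X\rangle$. $E$ (resp. $E^{(n)}$) is generated by anticommuting $e_1,e_2,\dots$ (resp. $e_1,\dots,e_n$) with $e_ie_j=-e_je_i$, having basis $1$ and products $e_{i_1}\cdots e_{i_k}$, $i_1<\dots<i_k$; the even part is the span of such products with $k$ even. *)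

theory Defs
  imports Main
begin

section \<open>Grassmann algebra E (basis e_S, S a finite subset of {1,2,...})\<close>

type_synonym 'k grass = "nat set \<Rightarrow> 'k"

definition gsign :: "nat set \<Rightarrow> nat set \<Rightarrow> 'k::ring_1" where
  "gsign S T = (if even (card {(i,j). i \<in> S \<and> j \<in> T \<and> j < i}) then 1 else -1)"

definition gmul :: "'k::ring_1 grass \<Rightarrow> 'k grass \<Rightarrow> 'k grass" where
  "gmul x y = (\<lambda>U. if finite U then (\<Sum>S\<in>Pow U. gsign S (U - S) * x S * y (U - S)) else 0)"

definition gadd :: "'k::ring_1 grass \<Rightarrow> 'k grass \<Rightarrow> 'k grass" where
  "gadd x y = (\<lambda>U. x U + y U)"

definition gzero :: "'k::ring_1 grass" where
  "gzero = (\<lambda>U. 0)"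

definition gone :: "'k::ring_1 grass" where
  "gone = (\<lambda>U. if U = {} then 1 else 0)"

definition grassmann :: "'k::ring_1 grass set" where
  "grassmann = {x. finite {S. x S \<noteq> 0} \<and> (\<forall>S. x S \<noteq> 0 \<longrightarrow> finite S \<and> 0 \<notin> S)}"

definition grassmann_fin :: "nat \<Rightarrow> 'k::ring_1 grass set" where
  "grassmann_fin n = {x \<in> grassmann. \<forall>S. x S \<noteq> 0 \<longrightarrow> S \<subseteq> {1..n}}"

definition grass_even :: "'k::ring_1 grass set \<Rightarrow> 'k grass set" where
  "grass_even X = {x \<in> X. \<forall>S. x S \<noteq> 0 \<longrightarrow> even (card S)}"

section \<open>Upper triangular 2x2 matrices ((a,b),(0,c)) over E\<close>

type_synonym 'k ut = "'k grass \<times> 'k grass \<times> 'k grass"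

definition utmul :: "'k::ring_1 ut \<Rightarrow> 'k ut \<Rightarrow> 'k ut" where
  "utmul X Y = (case X of (a, b, c) \<Rightarrow> case Y of (a', b', c') \<Rightarrow>
      (gmul a a', gadd (gmul a b') (gmul b c'), gmul c c'))"

definition utone :: "'k::ring_1 ut" where
  "utone = (gone, gzero, gone)"

definition utzero :: "'k::ring_1 ut" where
  "utzero = (gzero, gzero, gzero)"

definition UT_alg :: "'k::ring_1 grass set \<Rightarrow> 'k grass set \<Rightarrow> 'k ut set" where
  "UT_alg D0 D = {(a, b, c). a \<in> D0 \<and> b \<in> D \<and> c \<in> D}"

definition A_alg :: "'k::ring_1 ut set" where
  "A_alg = UT_alg (grass_even grassmann) grassmann"

definition A_fin :: "nat \<Rightarrow> 'k::ring_1 ut set" where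
  "A_fin n = UT_alg (grass_even (grassmann_fin n)) (grassmann_fin n)"

section \<open>Free unitary algebra K<X>, X = {x_1, x_2, ...} (variable x_i is letter i; letter 0 is one more variable)\<close>

type_synonym 'k ncpoly = "nat list \<Rightarrow> 'k"

definition free_alg :: "'k::ring_1 ncpoly set" where
  "free_alg = {f. finite {w. f w \<noteq> 0}}"

definition free_alg_n :: "nat \<Rightarrow> 'k::ring_1 ncpoly set" where
  "free_alg_n n = {f \<in> free_alg. \<forall>w. f w \<noteq> 0 \<longrightarrow> set w \<subseteq> {1..n}}"

definition pmul :: "'k::ring_1 ncpoly \<Rightarrow> 'k ncpoly \<Rightarrow> 'k ncpoly" where
  "pmul p q = (\<lambda>w. \<Sum>k\<le>length w. p (take k w) * q (drop k w))"

definition pone :: "'k::ring_1 ncpoly" where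
  "pone = (\<lambda>w. if w = [] then 1 else 0)"

definition ut_word :: "(nat \<Rightarrow> 'k::ring_1 ut) \<Rightarrow> nat list \<Rightarrow> 'k ut" where
  "ut_word phi w = foldr (\<lambda>i acc. utmul (phi i) acc) w utone"

definition ut_eval :: "(nat \<Rightarrow> 'k::ring_1 ut) \<Rightarrow> 'k ncpoly \<Rightarrow> 'k ut" where
  "ut_eval phi f =
     ((\<lambda>U. \<Sum>w\<in>{w. f w \<noteq> 0}. f w * fst (ut_word phi w) U),
      (\<lambda>U. \<Sum>w\<in>{w. f w \<noteq> 0}. f w * fst (snd (ut_word phi w)) U),
      (\<lambda>U. \<Sum>w\<in>{w. f w \<noteq> 0}. f w * snd (snd (ut_word phi w)) U))"

definition T_ut :: "'k::ring_1 ut set \<Rightarrow> 'k ncpoly set" where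
  "T_ut R = {f \<in> free_alg. \<forall>phi. (\<forall>i. phi i \<in> R) \<longrightarrow> ut_eval phi f = utzero}"

definition p_word :: "(nat \<Rightarrow> 'k::ring_1 ncpoly) \<Rightarrow> nat list \<Rightarrow> 'k ncpoly" where
  "p_word g w = foldr (\<lambda>i acc. pmul (g i) acc) w pone"

definition psubst :: "(nat \<Rightarrow> 'k::ring_1 ncpoly) \<Rightarrow> 'k ncpoly \<Rightarrow> 'k ncpoly" where
  "psubst g f = (\<lambda>v. \<Sum>w\<in>{w. f w \<noteq> 0}. f w * p_word g w v)"

text \<open>T(F_n(A)) for F_n(A) = K<x_1..x_n> / (K<x_1..x_n> \<inter> T(A)):
  the value of f at the classes [g_i] is the class of f(g_1,g_2,...), which is zero
  iff f(g_1,g_2,...) lies in T(A).\<close>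
definition T_Fn :: "nat \<Rightarrow> 'k::ring_1 ncpoly set" where
  "T_Fn n = {f \<in> free_alg. \<forall>g. (\<forall>i. g i \<in> free_alg_n n) \<longrightarrow> psubst g f \<in> T_ut A_alg}"

end

theory Submission
  imports Defs "HOL-Library.Multiset"
begin

text \<open>
  The elements \<open>X\<^sub>1 = Tri 0 0 (1 + e\<^sub>1)\<close>, \<open>X\<^sub>2 = Tri 0 1 e\<^sub>2\<close>, \<open>X\<^sub>i = Tri 0 0 e\<^sub>i\<close> (\<open>3 \<le> i \<le> n\<close>) of \<open>A\<close>
  generate the algebra of all matrices of \<open>A\<^sup>(\<^sup>n\<^sup>)\<close> with scalar upper left entry. An identity of
  \<open>F\<^sub>n(A)\<close> therefore vanishes at those matrices. Its value is a polynomial in the upper left entries,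
  which are central, and the field is infinite, so it vanishes on \<open>A\<^sup>(\<^sup>n\<^sup>)\<close>.

  Conversely, let \<open>f\<close> be an identity of \<open>A\<^sup>(\<^sup>n\<^sup>)\<close> and \<open>h\<close> a value of \<open>f\<close> at polynomials in \<open>n\<close> variables.
  Then \<open>h\<close> vanishes at the matrices \<open>Tri s\<^sub>i y\<^sub>i (t\<^sub>i + e\<^sub>i)\<close> with scalars \<open>s\<^sub>i, y\<^sub>i, t\<^sub>i\<close>. The \<open>e\<^sub>i\<close> may be
  specialised to arbitrary odd elements, the upper right entries enter linearly, and \<open>s\<^sub>i, t\<^sub>i\<close> may be
  replaced by even elements by the polynomial argument; this covers every substitution from \<open>A\<close>.
\<close>

subsection \<open>Signs\<close>

lemma finite_inversions:
  assumes "finite S" "finite T"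
  shows "finite {(i, j). i \<in> S \<and> j \<in> T \<and> j < (i::nat)}"
  by (rule finite_subset[of _ "S \<times> T"]) (use assms in auto)

text \<open>The exponent of the sign counts inversions, and these split along a disjoint union. With
  the version for the right argument this is the cocycle rule behind associativity of
  \<open>gmul\<close>.\<close>

lemma gsign_Un_left:
  assumes "finite S" "finite S'" "finite T" "S \<inter> S' = {}"
  shows "gsign (S \<union> S') T = gsign S T * (gsign S' T :: 'k::ring_1)"
proof -
  let ?I = "\<lambda>S. {(i, j). i \<in> S \<and> j \<in> T \<and> j < i}"
  have "card (?I (S \<union> S')) = card (?I S) + card (?I S')"
    using assms by (subst card_Un_disjoint[symmetric])
      (auto intro: finite_inversions intro!: arg_cong[where f = card])
  then show ?thesis by (auto simp: gsign_def)
qed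

lemma gsign_Un_right:
  assumes "finite S" "finite T" "finite T'" "T \<inter> T' = {}"
  shows "gsign S (T \<union> T') = gsign S T * (gsign S T' :: 'k::ring_1)"
proof -
  let ?I = "\<lambda>T. {(i, j). i \<in> S \<and> j \<in> T \<and> j < i}"
  have "card (?I (T \<union> T')) = card (?I T) + card (?I T')"
    using assms by (subst card_Un_disjoint[symmetric])
      (auto intro: finite_inversions intro!: arg_cong[where f = card])
  then show ?thesis by (auto simp: gsign_def)
qed

text \<open>Each pair in \<open>S \<times> T\<close> is out of order in exactly one of the two
  arrangements, so the two inversion counts add up to \<open>card S * card T\<close>.\<close>

lemma gsign_swap:
  assumes "finite S" "finite T" "S \<inter> T = {}"
  shows "gsign T S = (-1) ^ (card S * card T) * (gsign S T :: 'k::ring_1)"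
proof -
  let ?I = "{(i, j). i \<in> S \<and> j \<in> T \<and> j < i}" and ?J = "{(i, j). i \<in> T \<and> j \<in> S \<and> j < i}"
  have "card S * card T = card (?I \<union> prod.swap ` ?J)"
  proof -
    have "i < j \<or> j < i" if "i \<in> S" "j \<in> T" for i j
      using that assms(3) by (cases i j rule: linorder_cases) auto
    then have "S \<times> T = ?I \<union> prod.swap ` ?J" by (auto simp: image_iff) blast
    then show ?thesis by (simp flip: card_cartesian_product)
  qed
  also have "\<dots> = card ?I + card (prod.swap ` ?J)"
    by (rule card_Un_disjoint) (use assms in \<open>auto intro: finite_inversions\<close>)
  also have "card (prod.swap ` ?J) = card ?J" by (simp add: card_image)
  finally have "card S * card T = card ?I + card ?J" .
  then show ?thesis by (auto simp: gsign_def)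
qed

lemma gsign_empty [simp]: "gsign {} T = 1" "gsign S {} = 1"
  by (simp_all add: gsign_def)

lemma gsign_singleton:
  "gsign {i} T = (-1) ^ card {j \<in> T. j < i}"
proof -
  have "{(i', j). i' \<in> {i} \<and> j \<in> T \<and> j < i'} = Pair i ` {j \<in> T. j < i}" by auto
  then show ?thesis by (simp add: gsign_def card_image inj_on_def)
qed

subsection \<open>The Grassmann algebra as a ring\<close>

text \<open>Vanishing at infinite sets is exactly what makes \<open>gone\<close> neutral for
  \<open>gmul\<close>, and each coefficient of a product is a finite sum. Finite support is tracked
  separately, through \<open>grassmann\<close>.\<close>

typedef (overloaded) 'k gr = "{x :: 'k::zero grass. \<forall>S. infinite S \<longrightarrow> x S = 0}"
  morphisms coef Gr
  by (rule exI[of _ "\<lambda>_. 0"]) simp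

setup_lifting type_definition_gr

lemma coef_infinite [simp]: "infinite S \<Longrightarrow> coef x S = 0"
  using coef[of x] by simp

lemma gr_eqI: "(\<And>S. finite S \<Longrightarrow> coef x S = coef y S) \<Longrightarrow> x = y"
  by (metis coef_infinite coef_inject ext)

lemma gmul_assoc:
  fixes x y z :: "'k::comm_ring_1 grass"
  shows "gmul (gmul x y) z = gmul x (gmul y z)"
proof
  fix U
  show "gmul (gmul x y) z U = gmul x (gmul y z) U"
  proof (cases "finite U")
    case False
    then show ?thesis by (simp add: gmul_def)
  next
    case fin: True
    then have finU: "finite S" if "S \<subseteq> U" for S using that finite_subset by blast
    have "gmul (gmul x y) z U =
        (\<Sum>(S, T)\<in>Sigma (Pow U) Pow. gsign S (U - S) * gsign T (S - T) * x T * y (S - T) * z (U - S))"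
      using fin finU by (subst sum.Sigma[symmetric])
        (auto simp: gmul_def sum_distrib_left sum_distrib_right mult.assoc intro!: sum.cong)
    also have "\<dots> = (\<Sum>(T, V)\<in>Sigma (Pow U) (\<lambda>T. Pow (U - T)).
        gsign T (U - T) * gsign V (U - T - V) * x T * y V * z (U - T - V))"
    \<comment> \<open>Both sums run over splittings of \<open>U\<close> into three disjoint blocks,
      here \<open>T\<close>, \<open>S - T\<close> and \<open>U - S\<close>.\<close>
    proof (rule sum.reindex_bij_witness[of _ "\<lambda>(T, V). (T \<union> V, T)" "\<lambda>(S, T). (T, S - T)"], goal_cases)
      case (5 p)
      then obtain S T where p: "p = (S, T)" "T \<subseteq> S" "S \<subseteq> U" by auto
      have S: "T \<union> (S - T) = S" and UT: "(S - T) \<union> (U - S) = U - T" using p by auto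
      have "gsign S (U - S) = gsign T (U - S) * (gsign (S - T) (U - S) :: 'k)"
        using gsign_Un_left[of T "S - T" "U - S"] p finU[of S] finU[of T] fin unfolding S by auto
      moreover have "gsign T (U - T) = gsign T (S - T) * (gsign T (U - S) :: 'k)"
        using gsign_Un_right[of T "S - T" "U - S"] p finU[of S] finU[of T] fin unfolding UT by auto
      moreover have "U - T - (S - T) = U - S" using p by auto
      ultimately show ?case using p by (simp add: ac_simps)
    qed auto
    also have "\<dots> = gmul x (gmul y z) U"
      using fin finU by (subst sum.Sigma[symmetric])
        (auto simp: gmul_def sum_distrib_left ac_simps intro!: sum.cong)
    finally show ?thesis .
  qed
qed

lemma gmul_gone_left: "finite U \<Longrightarrow> gmul gone x U = x U"
  using sum.delta[of "Pow U" "{}" "\<lambda>S. gsign S (U - S) * x (U - S)"]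
  by (simp add: gmul_def gone_def if_distrib[of "\<lambda>u. _ * u * _"] cong: if_cong)

lemma gmul_gone_right:
  assumes "finite U"
  shows "gmul x gone U = x U"
proof -
  have "gmul x gone U = (\<Sum>S\<in>Pow U. gsign S (U - S) * x S * gone (U - S))"
    using assms by (simp add: gmul_def)
  also have "\<dots> = (\<Sum>S\<in>Pow U. if S = U then x U else 0)"
    by (rule sum.cong) (auto simp: gone_def)
  finally show ?thesis using assms by simp
qed

instantiation gr :: (comm_ring_1) ring_1
begin

lift_definition zero_gr :: "'a gr" is gzero by (simp add: gzero_def)
lift_definition one_gr :: "'a gr" is gone by (auto simp: gone_def)
lift_definition plus_gr :: "'a gr \<Rightarrow> 'a gr \<Rightarrow> 'a gr" is gadd by (simp add: gadd_def)
lift_definition uminus_gr :: "'a gr \<Rightarrow> 'a gr" is "\<lambda>x U. - x U" by simp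
lift_definition minus_gr :: "'a gr \<Rightarrow> 'a gr \<Rightarrow> 'a gr" is "\<lambda>x y U. x U - y U" by simp
lift_definition times_gr :: "'a gr \<Rightarrow> 'a gr \<Rightarrow> 'a gr" is gmul by (simp add: gmul_def)

instance
proof
  fix x y z :: "'a gr"
  show "x * y * z = x * (y * z)" by transfer (rule gmul_assoc)
  show "1 * x = x" by (rule gr_eqI) (simp add: times_gr.rep_eq one_gr.rep_eq gmul_gone_left)
  show "x * 1 = x" by (rule gr_eqI) (simp add: times_gr.rep_eq one_gr.rep_eq gmul_gone_right)
  show "(x + y) * z = x * z + y * z"
    by transfer (auto simp: gmul_def gadd_def algebra_simps sum.distrib)
  show "x * (y + z) = x * y + x * z"
    by transfer (auto simp: gmul_def gadd_def algebra_simps sum.distrib)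
  show "(0::'a gr) \<noteq> 1" by transfer (auto simp: gzero_def gone_def fun_eq_iff)
qed (transfer; auto simp: gadd_def gzero_def)+

end

section \<open>Coefficients, scalars and generators\<close>

lemma coef_simps [simp]:
  "coef 0 S = 0"
  "coef 1 S = (if S = {} then 1 else 0)"
  "coef (x + y) S = coef x S + coef y S"
  "coef (x - y) S = coef x S - coef y S"
  "coef (- x) S = - coef x S"
  by (transfer; simp add: gzero_def gone_def gadd_def)+

lemma coef_sum [simp]: "coef (sum f I) S = (\<Sum>i\<in>I. coef (f i) S)"
  by (induction I rule: infinite_finite_induct) auto

lemma coef_mult:
  "finite U \<Longrightarrow> coef (x * y) U = (\<Sum>S\<in>Pow U. gsign S (U - S) * coef x S * coef y (U - S))"
  by transfer (simp add: gmul_def)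

lift_definition scl :: "'k::comm_ring_1 \<Rightarrow> 'k gr" is "\<lambda>c S. if S = {} then c else 0"
  by auto

lift_definition gen :: "nat \<Rightarrow> 'k::comm_ring_1 gr" is "\<lambda>i S. if S = {i} then 1 else 0"
  by auto

lemma coef_scl: "coef (scl c) S = (if S = {} then c else 0)"
  by transfer simp

lemma coef_gen: "coef (gen i) S = (if S = {i} then 1 else 0)"
  by transfer simp

lemma coef_scl_mult [simp]: "coef (scl c * x) U = c * coef x U"
proof (cases "finite U")
  case True
  have "coef (scl c * x) U = (\<Sum>S\<in>Pow U. if S = {} then c * coef x U else 0)"
    unfolding coef_mult[OF True] by (rule sum.cong) (auto simp: coef_scl)
  then show ?thesis using True by simp
qed simp

lemma coef_gen_mult:
  assumes "finite U"
  shows "coef (gen i * x) U = (if i \<in> U then gsign {i} (U - {i}) * coef x (U - {i}) else 0)"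
proof -
  have "coef (gen i * x) U =
      (\<Sum>S\<in>Pow U. if S = {i} then gsign {i} (U - {i}) * coef x (U - {i}) else 0)"
    unfolding coef_mult[OF assms] by (rule sum.cong) (auto simp: coef_gen)
  then show ?thesis using assms by simp
qed

lemma scl_simps [simp]: "scl 0 = 0" "scl 1 = 1" "scl (a + b) = scl a + scl b"
  "scl (a * b) = scl a * scl b"
  by (rule gr_eqI; simp add: coef_scl)+

subsection \<open>Parity\<close>

text \<open>Infinite sets have \<open>card\<close> 0 and so count as even; coefficients at them are
  always 0, so neither parity notion is affected.\<close>

definition even_gr :: "'k::comm_ring_1 gr \<Rightarrow> bool" where
  "even_gr x \<longleftrightarrow> (\<forall>S. odd (card S) \<longrightarrow> coef x S = 0)"

definition odd_gr :: "'k::comm_ring_1 gr \<Rightarrow> bool" where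
  "odd_gr x \<longleftrightarrow> (\<forall>S. even (card S) \<longrightarrow> coef x S = 0)"

text \<open>Passing to complements in \<open>U\<close> turns the sum for \<open>x * y\<close> into
  the one for \<open>y * x\<close>, up to a sign that depends only on the two cardinalities; parity
  assumptions then decide this sign.\<close>

lemma coef_mult_swap:
  assumes "finite U"
  shows "coef (x * y) U = (\<Sum>S\<in>Pow U. (-1) ^ (card S * card (U - S)) *
           (gsign S (U - S) * coef y S * coef x (U - S)))"
proof -
  have fin: "finite S" if "S \<subseteq> U" for S using that assms finite_subset by blast
  have "coef (x * y) U = (\<Sum>S\<in>Pow U. gsign (U - S) S * coef x (U - S) * coef y S)"
    unfolding coef_mult[OF assms]
    by (rule sum.reindex_bij_witness[of _ "\<lambda>S. U - S" "\<lambda>S. U - S"]) (auto simp: double_diff)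
  also have "\<dots> = (\<Sum>S\<in>Pow U. (-1) ^ (card S * card (U - S)) *
           (gsign S (U - S) * coef y S * coef x (U - S)))"
    by (rule sum.cong) (auto simp: gsign_swap[of _ "U - _"] fin assms ac_simps)
  finally show ?thesis .
qed

lemma even_gr_commute:
  assumes "even_gr x"
  shows "x * y = y * x"
proof (rule gr_eqI)
  fix U :: "nat set" assume U: "finite U"
  show "coef (x * y) U = coef (y * x) U"
    unfolding coef_mult_swap[OF U, of y x] coef_mult[OF U, of x y]
    using assms by (intro sum.cong) (auto simp: even_gr_def minus_one_power_iff)
qed

lemma odd_gr_anticommute:
  assumes "odd_gr x" "odd_gr y"
  shows "x * y = - (y * x)"
proof (rule gr_eqI)
  fix U :: "nat set" assume U: "finite U"
  show "coef (x * y) U = coef (- (y * x)) U"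
    unfolding coef_simps coef_mult_swap[OF U, of y x] coef_mult[OF U, of x y] sum_negf[symmetric]
    using assms by (intro sum.cong) (auto simp: odd_gr_def minus_one_power_iff)
qed

lemma odd_gr_square:
  fixes x :: "'k::field_char_0 gr"
  assumes "odd_gr x"
  shows "x * x = 0"
proof (rule gr_eqI)
  fix U
  have "coef (x * x) U = - coef (x * x) U"
    using odd_gr_anticommute[OF assms assms] by (metis coef_simps(5))
  then show "coef (x * x) U = coef 0 U" by simp
qed

lemma even_gr_scl: "even_gr (scl c)"
  by (simp add: even_gr_def coef_scl)

lemma scl_commute: "x * scl c = scl c * x"
  using even_gr_commute[OF even_gr_scl] by metis

lemma even_odd_decomp:
  obtains u v where "even_gr u" "odd_gr v" "x = u + v"
proof
  define u where "u = Gr (\<lambda>S. if even (card S) then coef x S else 0)"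
  have u: "coef u S = (if even (card S) then coef x S else 0)" for S
    unfolding u_def by (subst Gr_inverse) auto
  show "even_gr u" by (simp add: even_gr_def u)
  show "odd_gr (x - u)" by (simp add: odd_gr_def u)
  show "x = u + (x - u)" by simp
qed

subsection \<open>Polynomial functions of even arguments\<close>

text \<open>Distinct commutative monomials are distinct characters of the multiplicative monoid
  of points, so Dedekind's independence argument applies.\<close>
lemma sorted_monomials_independent:
  fixes c :: "nat list \<Rightarrow> 'k::field_char_0"
  assumes "finite V" "\<And>v. v \<in> V \<Longrightarrow> sorted v"
    and "\<And>x :: nat \<Rightarrow> 'k. (\<Sum>v\<in>V. prod_list (map x v) * c v) = 0"
  shows "\<forall>v\<in>V. c v = 0"
  using assms
proof (induction V arbitrary: c rule: finite_induct)
  case (insert u V)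
  have mult: "prod_list (map (\<lambda>i. x i * y i) v) = prod_list (map x v) * prod_list (map y v)"
    for x y :: "nat \<Rightarrow> 'k" and v by (induction v) auto
  have V0: "c v = 0" if v: "v \<in> V" for v
  proof -
    have "v \<noteq> u" "sorted v" "sorted u" using v insert by auto
    then have "mset v \<noteq> mset u" using properties_for_sort[of v u] properties_for_sort[of u u] by auto
    then obtain i where i: "count (mset v) i \<noteq> count (mset u) i" by (auto simp: multiset_eq_iff)
    \<comment> \<open>The letter \<open>i\<close> separates \<open>v\<close> from \<open>u\<close>.
      Rescaling a point by 2 in this coordinate multiplies the monomial \<open>w\<close> by
      \<open>2 ^ count (mset w) i\<close>, so subtracting a multiple of the original relation
      eliminates \<open>u\<close>.\<close>
    define y :: "nat \<Rightarrow> 'k" where "y = (\<lambda>j. if j = i then 2 else 1)"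
    have y: "prod_list (map y w) = 2 ^ count (mset w) i" for w
      by (induction w) (auto simp: y_def)
    define c' where "c' w = (prod_list (map y w) - prod_list (map y u)) * c w" for w
    have "(\<Sum>w\<in>V. prod_list (map x w) * c' w) = 0" for x
    proof -
      have "(\<Sum>w\<in>insert u V. prod_list (map (\<lambda>i. x i * y i) w) * c w) -
          prod_list (map y u) * (\<Sum>w\<in>insert u V. prod_list (map x w) * c w) = 0"
        using insert.prems(2) by simp
      then show ?thesis using insert.hyps
        by (simp add: mult c'_def algebra_simps sum_subtractf sum_distrib_left sum_distrib_right)
    qed
    then have "c' v = 0" using insert.IH[of c'] insert.prems(1) v by auto
    moreover have "(2::'k) ^ count (mset v) i \<noteq> 2 ^ count (mset u) i"
    proof -
      have "of_nat (2 ^ count (mset v) i) \<noteq> (of_nat (2 ^ count (mset u) i) :: 'k)"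
        using i unfolding of_nat_eq_iff by simp
      then show ?thesis by simp
    qed
    ultimately show ?thesis by (simp add: c'_def y)
  qed
  have "c u = 0"
    using insert.prems(2)[of "\<lambda>_. 1"] insert.hyps V0 by (simp add: map_replicate_const)
  then show ?case using V0 by simp
qed simp

text \<open>A polynomial is kept as a list of words with coefficients on the right, so that sums are
  concatenations. Agreement is demanded at even arguments, where the variables are central and
  coefficients can be moved past them.\<close>

definition poly_fun :: "((nat \<Rightarrow> 'k::comm_ring_1 gr) \<Rightarrow> 'k gr) \<Rightarrow> bool" where
  "poly_fun F \<longleftrightarrow> (\<exists>xs. \<forall>z. (\<forall>i. even_gr (z i)) \<longrightarrow>
     F z = (\<Sum>(w, d)\<leftarrow>xs. prod_list (map z w) * d))"

lemma poly_fun_const: "poly_fun (\<lambda>z. d)"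
  unfolding poly_fun_def by (rule exI[of _ "[([], d)]"]) simp

lemma poly_fun_add:
  assumes "poly_fun F" "poly_fun G"
  shows "poly_fun (\<lambda>z. F z + G z)"
proof -
  from assms obtain xs ys where
    "\<forall>z. (\<forall>i. even_gr (z i)) \<longrightarrow> F z = (\<Sum>(w, d)\<leftarrow>xs. prod_list (map z w) * d)"
    "\<forall>z. (\<forall>i. even_gr (z i)) \<longrightarrow> G z = (\<Sum>(w, d)\<leftarrow>ys. prod_list (map z w) * d)"
    unfolding poly_fun_def by blast
  then show ?thesis unfolding poly_fun_def by (intro exI[of _ "xs @ ys"]) simp
qed

lemma poly_fun_sum: "(\<And>i. i \<in> I \<Longrightarrow> poly_fun (F i)) \<Longrightarrow> poly_fun (\<lambda>z. \<Sum>i\<in>I. F i z)"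
  by (induction I rule: infinite_finite_induct) (auto intro: poly_fun_const poly_fun_add)

lemma poly_fun_var_mult:
  assumes "poly_fun F"
  shows "poly_fun (\<lambda>z. z i * F z)"
proof -
  from assms obtain xs where
    xs: "\<forall>z. (\<forall>i. even_gr (z i)) \<longrightarrow> F z = (\<Sum>(w, d)\<leftarrow>xs. prod_list (map z w) * d)"
    unfolding poly_fun_def by blast
  have "z i * (\<Sum>(w, d)\<leftarrow>xs. prod_list (map z w) * d) =
      (\<Sum>(w, d)\<leftarrow>map (\<lambda>(w, d). (i # w, d)) xs. prod_list (map z w) * d)" for z
    by (induction xs) (auto simp: algebra_simps)
  with xs show ?thesis unfolding poly_fun_def
    by (intro exI[of _ "map (\<lambda>(w, d). (i # w, d)) xs"]) simp
qed

lemma prod_list_even_commute: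
  assumes "\<And>i. even_gr (z i)"
  shows "prod_list (map z w) * x = x * prod_list (map z w)"
proof (induction w)
  case (Cons i w)
  have "z i * (prod_list (map z w) * x) = z i * x * prod_list (map z w)"
    by (simp only: Cons mult.assoc)
  also have "\<dots> = x * (z i * prod_list (map z w))"
    by (simp only: even_gr_commute[OF assms[of i], of x] mult.assoc)
  finally show ?case by (simp add: mult.assoc)
qed simp

text \<open>Centrality of the even arguments lets the constant pass the monomial and join the
  coefficient.\<close>

lemma poly_fun_const_mult:
  assumes "poly_fun F"
  shows "poly_fun (\<lambda>z. a * F z)"
proof -
  from assms obtain xs where
    xs: "\<forall>z. (\<forall>i. even_gr (z i)) \<longrightarrow> F z = (\<Sum>(w, d)\<leftarrow>xs. prod_list (map z w) * d)"
    unfolding poly_fun_def by blast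
  have "a * (\<Sum>(w, d)\<leftarrow>xs. prod_list (map z w) * d) =
      (\<Sum>(w, d)\<leftarrow>map (\<lambda>(w, d). (w, a * d)) xs. prod_list (map z w) * d)"
    if "\<forall>i. even_gr (z i)" for z
  proof (induction xs)
    case (Cons p xs)
    have "a * (prod_list (map z w) * d) = prod_list (map z w) * (a * d)" for w d
      using that prod_list_even_commute[of z w a] by (simp only: flip: mult.assoc)
    with Cons show ?case by (cases p) (simp add: distrib_left)
  qed simp
  with xs show ?thesis unfolding poly_fun_def
    by (intro exI[of _ "map (\<lambda>(w, d). (w, a * d)) xs"]) simp
qed

lemma prod_list_even_sort:
  assumes "\<And>i. even_gr (z i)"
  shows "prod_list (map z (sort w)) = prod_list (map z w)"
proof -
  have "prod_list (map z (insort i w)) = z i * prod_list (map z w)" for i w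
  proof (induction w)
    case (Cons j w)
    have "z j * (z i * prod_list (map z w)) = z i * (z j * prod_list (map z w))"
      by (simp only: even_gr_commute[OF assms[of i], of "z j"] flip: mult.assoc)
    then show ?case using Cons by simp
  qed simp
  then show ?thesis by (induction w) auto
qed

text \<open>After equal commutative monomials are collected, the coefficient at a basis set
  \<open>U\<close> of the values at scalar points is a polynomial over the field that vanishes
  everywhere. By independence of the monomials every collected coefficient is 0, hence so is the
  value at even points.\<close>

lemma poly_fun_eq_0:
  fixes F :: "(nat \<Rightarrow> 'k::field_char_0 gr) \<Rightarrow> 'k gr"
  assumes "poly_fun F" and F0: "\<And>x. F (\<lambda>i. scl (x i)) = 0" and z: "\<And>i. even_gr (z i)"
  shows "F z = 0"
proof -
  obtain xs where
    xs: "\<And>z. (\<And>i. even_gr (z i)) \<Longrightarrow> F z = (\<Sum>(w, d)\<leftarrow>xs. prod_list (map z w) * d)"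
    using assms(1) unfolding poly_fun_def by blast
  define V where "V = (sort \<circ> fst) ` set xs"
  define D where "D v = (\<Sum>(w, d)\<leftarrow>xs. if sort w = v then d else 0)" for v
  have FD: "F z = (\<Sum>v\<in>V. prod_list (map z v) * D v)" if z: "\<And>i. even_gr (z i)" for z
  proof -
    \<comment> \<open>The sum runs over a fixed \<open>W\<close> containing all sorted words of the
      list, since \<open>V\<close> itself would change with the list in the induction.\<close>
    have "(\<Sum>v\<in>W. prod_list (map z v) * (\<Sum>(w, d)\<leftarrow>ys. if sort w = v then d else 0)) =
        (\<Sum>(w, d)\<leftarrow>ys. prod_list (map z w) * d)"
      if "finite W" "(sort \<circ> fst) ` set ys \<subseteq> W" for W ys
      using that(2)
    proof (induction ys)
      case (Cons p ys)
      obtain w d where p: "p = (w, d)" by fastforce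
      have "(\<Sum>v\<in>W. prod_list (map z v) * (if sort w = v then d else 0)) =
          (\<Sum>v\<in>W. if sort w = v then prod_list (map z (sort w)) * d else 0)"
        by (rule sum.cong) auto
      also have "\<dots> = prod_list (map z w) * d"
        using \<open>finite W\<close> Cons.prems by (simp add: p prod_list_even_sort z)
      finally show ?case using Cons by (simp add: p distrib_left sum.distrib)
    qed simp
    from this[of V xs] show ?thesis by (simp add: xs z V_def D_def)
  qed
  have scl_prod: "prod_list (map (\<lambda>i. scl (x i)) v) = scl (prod_list (map x v))"
    for x :: "nat \<Rightarrow> 'k" and v by (induction v) auto
  have "coef (D v) U = 0" if "v \<in> V" for v U
  proof -
    have "(\<Sum>v\<in>V. prod_list (map x v) * coef (D v) U) = 0" for x
    proof -
      have "coef (\<Sum>v\<in>V. prod_list (map (\<lambda>i. scl (x i)) v) * D v) U = 0"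
        using FD[of "\<lambda>i. scl (x i)"] F0[of x] by (simp only: even_gr_scl coef_simps)
      then show ?thesis by (simp add: scl_prod)
    qed
    moreover have "finite V" "\<And>v. v \<in> V \<Longrightarrow> sorted v" by (auto simp: V_def)
    ultimately show ?thesis
      using sorted_monomials_independent[of V "\<lambda>v. coef (D v) U"] that by blast
  qed
  then have "D v = 0" if "v \<in> V" for v using that by (intro gr_eqI) simp
  then show ?thesis using FD[OF z] by simp
qed

subsection \<open>Products of anticommuting elements\<close>

text \<open>This is what the basis monomial indexed by \<open>S\<close> becomes when each
  \<open>e_i\<close> is replaced by \<open>u i\<close>.\<close>

definition ordered_prod :: "(nat \<Rightarrow> 'k::comm_ring_1 gr) \<Rightarrow> nat set \<Rightarrow> 'k gr" where
  "ordered_prod u S = prod_list (map u (sorted_list_of_set S))"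

lemma ordered_prod_insert_min:
  assumes "finite S" "\<And>j. j \<in> S \<Longrightarrow> i < j"
  shows "ordered_prod u (insert i S) = u i * ordered_prod u S"
proof -
  have "sorted_list_of_set (insert i S) = i # sorted_list_of_set S"
    using assms by (subst sorted_list_of_set_insert) (auto simp: insort_is_Cons less_imp_le)
  then show ?thesis by (simp add: ordered_prod_def)
qed

text \<open>Odd elements anticommute and square to 0, so they obey the multiplication rule of the
  Grassmann basis. The induction removes the least index \<open>b\<close>: \<open>u i\<close> stays
  in front if \<open>i < b\<close>, a square appears if \<open>i = b\<close>, and otherwise passing
  \<open>u b\<close> costs one sign.\<close>

lemma mult_ordered_prod:
  fixes u :: "nat \<Rightarrow> 'k::field_char_0 gr"
  assumes "\<And>i. odd_gr (u i)" "finite S"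
  shows "u i * ordered_prod u S =
    (if i \<in> S then 0 else scl (gsign {i} S) * ordered_prod u (insert i S))"
  using assms(2)
proof (induction S rule: finite_linorder_min_induct)
  case empty
  show ?case using ordered_prod_insert_min[of "{}" i u] by simp
next
  case (insert b A)
  consider "i < b" | "i = b" | "b < i" by (rule linorder_cases)
  then show ?case
  proof cases
    case 1
    then have none: "{j \<in> insert b A. j < i} = {}" and "i \<notin> insert b A" using insert by auto
    have "gsign {i} (insert b A) = (1::'k)" unfolding gsign_singleton none by simp
    moreover have "ordered_prod u (insert i (insert b A)) = u i * ordered_prod u (insert b A)"
      using insert 1 by (intro ordered_prod_insert_min) auto
    ultimately show ?thesis using \<open>i \<notin> insert b A\<close> by (simp del: insert_iff)
  next
    case 2
    have "u b * (u b * ordered_prod u A) = 0"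
      by (simp add: odd_gr_square[OF assms(1)[of b]] flip: mult.assoc)
    then show ?thesis using 2 insert.hyps by (simp add: ordered_prod_insert_min)
  next
    case 3
    have "u i * ordered_prod u (insert b A) = (u i * u b) * ordered_prod u A"
      using insert.hyps by (simp add: ordered_prod_insert_min mult.assoc)
    also have "\<dots> = - u b * (u i * ordered_prod u A)"
      unfolding odd_gr_anticommute[OF assms(1)[of i] assms(1)[of b]] by (simp add: mult.assoc)
    finally have "u i * ordered_prod u (insert b A) = - u b * (u i * ordered_prod u A)" .
    also have "\<dots> = (if i \<in> A then 0 else
        - scl (gsign {i} A) * (u b * ordered_prod u (insert i A)))"
      unfolding insert.IH by (simp add: scl_commute[of "u b"] flip: mult.assoc)
    also have "\<dots> = (if i \<in> insert b A then 0 else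
        scl (gsign {i} (insert b A)) * ordered_prod u (insert i (insert b A)))"
    proof (cases "i \<in> A")
      case False
      have "{j \<in> insert b A. j < i} = insert b {j \<in> A. j < i}" using 3 by auto
      moreover have "b \<notin> A" using insert by auto
      ultimately have "gsign {i} (insert b A) = - (gsign {i} A :: 'k)"
        unfolding gsign_singleton using insert.hyps by simp
      moreover have "ordered_prod u (insert i (insert b A)) = u b * ordered_prod u (insert i A)"
        using insert.hyps 3 by (subst insert_commute, intro ordered_prod_insert_min) auto
      moreover have "scl (- c) = - scl c" for c :: 'k by (rule gr_eqI) (simp add: coef_scl)
      ultimately show ?thesis using False 3 by simp
    qed simp
    finally show ?thesis .
  qed
qed

text \<open>The least generator is multiplied from the left, so no sign arises; this identifies the
  ordered products of generators with the basis.\<close>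

lemma coef_ordered_prod_gen:
  "finite S \<Longrightarrow> coef (ordered_prod gen S) U = (if U = S then 1 else 0)"
proof (induction S arbitrary: U rule: finite_linorder_min_induct)
  case empty
  show ?case by (simp add: ordered_prod_def)
next
  case (insert b A)
  have prod: "ordered_prod gen (insert b A) = gen b * ordered_prod gen A"
    using insert by (intro ordered_prod_insert_min) auto
  have none: "{j \<in> A. j < b} = {}" and "b \<notin> A" using insert by auto
  show ?case
  proof (cases "finite U")
    case False
    then show ?thesis using insert(1) by auto
  next
    case True
    have "b \<in> U \<and> U - {b} = A \<longleftrightarrow> U = insert b A" using \<open>b \<notin> A\<close> by auto
    moreover have "gsign {b} A = 1" unfolding gsign_singleton none by simp
    ultimately show ?thesis unfolding prod coef_gen_mult[OF True] insert.IH by auto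
  qed
qed

subsection \<open>Upper triangular matrices\<close>

datatype 'r tri = Tri (t11: 'r) (t12: 'r) (t22: 'r)

instantiation tri :: (ring_1) ring_1
begin

definition "0 = Tri 0 0 (0::'a)"
definition "1 = Tri 1 0 (1::'a)"
definition "x + y = Tri (t11 x + t11 y) (t12 x + t12 y) (t22 x + t22 (y :: 'a tri))"
definition "x - y = Tri (t11 x - t11 y) (t12 x - t12 y) (t22 x - t22 (y :: 'a tri))"
definition "- x = Tri (- t11 x) (- t12 x) (- t22 (x :: 'a tri))"
definition "x * y = Tri (t11 x * t11 y) (t11 x * t12 y + t12 x * t22 y) (t22 x * t22 (y :: 'a tri))"

instance
  by standard (simp_all add: zero_tri_def one_tri_def plus_tri_def minus_tri_def uminus_tri_def
      times_tri_def algebra_simps tri.expand)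

end

lemma tri_simps [simp]:
  "t11 0 = (0::'r::ring_1)" "t12 0 = (0::'r)" "t22 0 = (0::'r)"
  "t11 1 = (1::'r)" "t12 1 = (0::'r)" "t22 1 = (1::'r)"
  "t11 (x + y) = t11 x + (t11 y :: 'r)" "t12 (x + y) = t12 x + (t12 y :: 'r)"
  "t22 (x + y) = t22 x + (t22 y :: 'r)"
  "t11 (x - y) = t11 x - (t11 y :: 'r)" "t12 (x - y) = t12 x - (t12 y :: 'r)"
  "t22 (x - y) = t22 x - (t22 y :: 'r)"
  "t11 (x * y) = t11 x * (t11 y :: 'r)" "t12 (x * y) = t11 x * t12 y + t12 x * (t22 y :: 'r)"
  "t22 (x * y) = t22 x * (t22 y :: 'r)"
  by (simp_all add: zero_tri_def one_tri_def plus_tri_def minus_tri_def times_tri_def)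

lemma tri_sum [simp]:
  "t11 (sum f I) = (\<Sum>i\<in>I. t11 (f i :: 'r::ring_1 tri))"
  "t12 (sum f I) = (\<Sum>i\<in>I. t12 (f i))"
  "t22 (sum f I) = (\<Sum>i\<in>I. t22 (f i))"
  by (induction I rule: infinite_finite_induct; simp)+

definition tscl :: "'k::comm_ring_1 \<Rightarrow> 'k gr tri" where
  "tscl c = Tri (scl c) 0 (scl c)"

lemma tscl_sel [simp]: "t11 (tscl c) = scl c" "t12 (tscl c) = 0" "t22 (tscl c) = scl c"
  by (simp_all add: tscl_def)

lemma tscl_simps [simp]: "tscl 0 = 0" "tscl 1 = 1" "tscl (a + b) = tscl a + tscl b"
  "tscl (a * b) = tscl a * tscl b"
  by (simp_all add: tri.expand)

lemma tscl_sum: "tscl (sum f I) = (\<Sum>i\<in>I. tscl (f i))"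
  by (induction I rule: infinite_finite_induct) auto

lemma tscl_commute: "x * tscl c = tscl c * x"
  by (simp add: tri.expand scl_commute)

subsection \<open>Evaluation of noncommutative polynomials\<close>

definition peval :: "(nat \<Rightarrow> 'k::comm_ring_1 gr tri) \<Rightarrow> 'k ncpoly \<Rightarrow> 'k gr tri" where
  "peval \<phi> f = (\<Sum>w | f w \<noteq> 0. tscl (f w) * prod_list (map \<phi> w))"

lemma peval_superset:
  assumes "finite W" "\<And>w. f w \<noteq> 0 \<Longrightarrow> w \<in> W"
  shows "peval \<phi> f = (\<Sum>w\<in>W. tscl (f w) * prod_list (map \<phi> w))"
  unfolding peval_def using assms by (intro sum.mono_neutral_left) auto

lemma peval_cong:
  assumes "\<And>w i. f w \<noteq> 0 \<Longrightarrow> i \<in> set w \<Longrightarrow> \<phi> i = \<psi> i"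
  shows "peval \<phi> f = peval \<psi> f"
  unfolding peval_def using assms by (intro sum.cong arg_cong2[where f = times] arg_cong[where f = prod_list]) auto

lemma pmul_supp:
  "{w. pmul p q w \<noteq> 0} \<subseteq> (\<lambda>(u, v). u @ v) ` ({w. p w \<noteq> 0} \<times> {w. q w \<noteq> 0})"
proof
  fix w assume "w \<in> {w. pmul p q w \<noteq> 0}"
  then obtain k where "p (take k w) * q (drop k w) \<noteq> 0"
    unfolding pmul_def mem_Collect_eq by (meson sum.not_neutral_contains_not_neutral)
  then show "w \<in> (\<lambda>(u, v). u @ v) ` ({w. p w \<noteq> 0} \<times> {w. q w \<noteq> 0})"
    by (intro image_eqI[of _ _ "(take k w, drop k w)"]) auto
qed

lemma pmul_conv:
  assumes "finite P" "finite Q" "\<And>u. p u \<noteq> 0 \<Longrightarrow> u \<in> P" "\<And>v. q v \<noteq> 0 \<Longrightarrow> v \<in> Q"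
  shows "pmul p q w = (\<Sum>(u, v)\<in>{(u, v). (u, v) \<in> P \<times> Q \<and> u @ v = w}. p u * q v)"
proof -
  have fin: "finite {(u, v). (u, v) \<in> P \<times> Q \<and> u @ v = w}"
    by (rule finite_subset[of _ "P \<times> Q"]) (use assms in auto)
  have nz: "u \<in> P \<and> v \<in> Q" if "p u * q v \<noteq> 0" for u v
    using that assms(3,4) by (metis mult_zero_left mult_zero_right)
  have "pmul p q w = (\<Sum>(u, v)\<in>(\<lambda>k. (take k w, drop k w)) ` {..length w}. p u * q v)"
    unfolding pmul_def
    by (subst sum.reindex) (auto simp: inj_on_def dest!: arg_cong[where f = length])
  also have "\<dots> = (\<Sum>(u, v)\<in>{(u, v). (u, v) \<in> P \<times> Q \<and> u @ v = w}. p u * q v)"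
  proof (rule sum.mono_neutral_cong[OF fin])
    fix x assume x: "x \<in> {(u, v). (u, v) \<in> P \<times> Q \<and> u @ v = w} - (\<lambda>k. (take k w, drop k w)) ` {..length w}"
    then obtain u v where "x = (u, v)" "u @ v = w" by auto
    moreover from this have "x = (\<lambda>k. (take k w, drop k w)) (length u)" "length u \<le> length w" by auto
    ultimately show "(case x of (u, v) \<Rightarrow> p u * q v) = 0" using x by blast
  qed (use nz in auto)
  finally show ?thesis .
qed

text \<open>Pairs of words are grouped by their concatenation, and the coefficients pass the words
  because scalar matrices are central.\<close>

lemma peval_pmul:
  assumes "p \<in> free_alg" "q \<in> free_alg"
  shows "peval \<phi> (pmul p q) = peval \<phi> p * peval \<phi> q"
proof -
  define P Q where "P = {w. p w \<noteq> 0}" and "Q = {w. q w \<noteq> 0}"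
  have fin: "finite P" "finite Q" using assms by (auto simp: P_def Q_def free_alg_def)
  define W where "W = (\<lambda>(u, v). u @ v) ` (P \<times> Q)"
  have "peval \<phi> (pmul p q) = (\<Sum>w\<in>W. tscl (pmul p q w) * prod_list (map \<phi> w))"
    by (rule peval_superset) (use fin pmul_supp[of p q] in \<open>auto simp: W_def P_def Q_def\<close>)
  also have "\<dots> = (\<Sum>w\<in>W. \<Sum>x | x \<in> P \<times> Q \<and> (\<lambda>(u, v). u @ v) x = w.
      tscl (p (fst x)) * prod_list (map \<phi> (fst x)) * (tscl (q (snd x)) * prod_list (map \<phi> (snd x))))"
  proof (rule sum.cong[OF refl])
    fix w
    have "{(u, v). (u, v) \<in> P \<times> Q \<and> u @ v = w} = {x. x \<in> P \<times> Q \<and> (\<lambda>(u, v). u @ v) x = w}"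
      by auto
    then have "pmul p q w = (\<Sum>x | x \<in> P \<times> Q \<and> (\<lambda>(u, v). u @ v) x = w. p (fst x) * q (snd x))"
      using pmul_conv[OF fin, of p q w] by (simp add: P_def Q_def case_prod_beta)
    then have "tscl (pmul p q w) * prod_list (map \<phi> w) =
      (\<Sum>x | x \<in> P \<times> Q \<and> (\<lambda>(u, v). u @ v) x = w. tscl (p (fst x) * q (snd x)) * prod_list (map \<phi> w))"
      by (simp only: tscl_sum sum_distrib_right)
    also have "\<dots> = (\<Sum>x | x \<in> P \<times> Q \<and> (\<lambda>(u, v). u @ v) x = w.
      tscl (p (fst x)) * prod_list (map \<phi> (fst x)) * (tscl (q (snd x)) * prod_list (map \<phi> (snd x))))"
    proof (rule sum.cong[OF refl], clarsimp)
      fix u v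
      have "prod_list (map \<phi> u) * (tscl (q v) * prod_list (map \<phi> v)) =
          tscl (q v) * (prod_list (map \<phi> u) * prod_list (map \<phi> v))"
        by (simp add: tscl_commute[of "prod_list (map \<phi> u)"] flip: mult.assoc)
      then show "tscl (p u) * tscl (q v) * (prod_list (map \<phi> u) * prod_list (map \<phi> v)) =
          tscl (p u) * prod_list (map \<phi> u) * (tscl (q v) * prod_list (map \<phi> v))"
        by (simp add: mult.assoc)
    qed
    finally show "tscl (pmul p q w) * prod_list (map \<phi> w) = \<dots>" .
  qed
  also have "\<dots> = (\<Sum>x\<in>P \<times> Q.
      tscl (p (fst x)) * prod_list (map \<phi> (fst x)) * (tscl (q (snd x)) * prod_list (map \<phi> (snd x))))"
    using fin by (intro sum.group) (auto simp: W_def)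
  also have "\<dots> = peval \<phi> p * peval \<phi> q"
    unfolding peval_def P_def Q_def by (simp add: sum_product sum.cartesian_product case_prod_beta)
  finally show ?thesis .
qed

section \<open>Substitution into polynomials in n variables\<close>

lemma free_alg_n_pmul:
  assumes "p \<in> free_alg_n n" "q \<in> free_alg_n n"
  shows "pmul p q \<in> free_alg_n n"
proof -
  have "finite {w. pmul p q w \<noteq> 0}"
    by (rule finite_subset[OF pmul_supp]) (use assms in \<open>auto simp: free_alg_n_def free_alg_def\<close>)
  moreover have "set w \<subseteq> {1..n}" if nz: "pmul p q w \<noteq> 0" for w
  proof -
    obtain u v where "w = u @ v" "p u \<noteq> 0" "q v \<noteq> 0" using subsetD[OF pmul_supp, of w p q] nz by auto
    then show ?thesis using assms by (simp add: free_alg_n_def)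
  qed
  ultimately show ?thesis by (simp add: free_alg_n_def free_alg_def)
qed

lemma free_alg_n_lincomb:
  assumes "finite I" "\<And>i. i \<in> I \<Longrightarrow> p i \<in> free_alg_n n"
  shows "(\<lambda>w. \<Sum>i\<in>I. c i * p i w) \<in> free_alg_n n"
proof -
  have ex: "\<exists>i\<in>I. p i w \<noteq> 0" if "(\<Sum>i\<in>I. c i * p i w) \<noteq> 0" for w
    using that by (rule contrapos_np) simp
  have "finite {w. (\<Sum>i\<in>I. c i * p i w) \<noteq> 0}"
    by (rule finite_subset[of _ "\<Union>i\<in>I. {w. p i w \<noteq> 0}"])
      (use assms ex in \<open>auto simp: free_alg_n_def free_alg_def\<close>)
  then show ?thesis using assms(2) ex unfolding free_alg_n_def free_alg_def by blast
qed

lemma peval_lincomb: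
  assumes "finite I" "\<And>i. i \<in> I \<Longrightarrow> p i \<in> free_alg"
  shows "peval \<phi> (\<lambda>w. \<Sum>i\<in>I. c i * p i w) = (\<Sum>i\<in>I. tscl (c i) * peval \<phi> (p i))"
proof -
  define W where "W = (\<Union>i\<in>I. {w. p i w \<noteq> 0})"
  have fin: "finite W" using assms by (auto simp: W_def free_alg_def)
  have "peval \<phi> (\<lambda>w. \<Sum>i\<in>I. c i * p i w) =
      (\<Sum>w\<in>W. tscl (\<Sum>i\<in>I. c i * p i w) * prod_list (map \<phi> w))"
    by (rule peval_superset[OF fin], rule ccontr) (simp add: W_def)
  also have "\<dots> = (\<Sum>i\<in>I. \<Sum>w\<in>W. tscl (c i) * (tscl (p i w) * prod_list (map \<phi> w)))"
    by (subst sum.swap) (simp add: tscl_sum sum_distrib_right mult.assoc)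
  also have "\<dots> = (\<Sum>i\<in>I. tscl (c i) * peval \<phi> (p i))"
    by (rule sum.cong[OF refl], subst peval_superset[OF fin]) (auto simp: W_def sum_distrib_left)
  finally show ?thesis .
qed

lemma free_alg_n_pone: "pone \<in> free_alg_n n"
  by (auto simp: free_alg_n_def free_alg_def pone_def intro: finite_subset[of _ "{[]}"])

lemma peval_pone: "peval \<phi> pone = 1"
  by (subst peval_superset[of "{[]}"]) (auto simp: pone_def split: if_splits)

lemma free_alg_n_subset: "p \<in> free_alg_n n \<Longrightarrow> p \<in> free_alg"
  by (simp add: free_alg_n_def)

lemma free_alg_n_p_word: "(\<And>i. g i \<in> free_alg_n n) \<Longrightarrow> p_word g w \<in> free_alg_n n"
  by (induction w) (auto simp: p_word_def free_alg_n_pone free_alg_n_pmul)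

lemma peval_p_word:
  assumes "\<And>i. g i \<in> free_alg_n n"
  shows "peval \<phi> (p_word g w) = prod_list (map (\<lambda>i. peval \<phi> (g i)) w)"
proof (induction w)
  case (Cons i w)
  have "p_word g (i # w) = pmul (g i) (p_word g w)" by (simp add: p_word_def)
  then show ?case
    using Cons peval_pmul[of "g i" "p_word g w" \<phi>] free_alg_n_subset[OF assms]
      free_alg_n_subset[OF free_alg_n_p_word[OF assms]] by simp
qed (simp add: p_word_def peval_pone)

lemma free_alg_n_psubst:
  assumes "f \<in> free_alg" "\<And>i. g i \<in> free_alg_n n"
  shows "psubst g f \<in> free_alg_n n"
  unfolding psubst_def
  by (rule free_alg_n_lincomb) (use assms in \<open>auto simp: free_alg_def intro: free_alg_n_p_word\<close>)

text \<open>Evaluation is linear and multiplicative, so it commutes with substitution. Both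
  inclusions use this to turn \<open>psubst g f\<close> into \<open>f\<close> evaluated at the
  values of the \<open>g i\<close>.\<close>

lemma peval_psubst:
  assumes "f \<in> free_alg" "\<And>i. g i \<in> free_alg_n n"
  shows "peval \<phi> (psubst g f) = peval (\<lambda>i. peval \<phi> (g i)) f"
proof -
  have "peval \<phi> (psubst g f) = (\<Sum>w | f w \<noteq> 0. tscl (f w) * peval \<phi> (p_word g w))"
    unfolding psubst_def
    using assms(1) free_alg_n_subset[OF free_alg_n_p_word[OF assms(2)]]
    by (intro peval_lincomb) (simp_all add: free_alg_def)
  then show ?thesis using peval_p_word[of g n \<phi>] assms(2) by (simp add: peval_def[of _ f])
qed

subsection \<open>Translation to the concrete algebras\<close>

definition ut_of :: "'k::comm_ring_1 gr tri \<Rightarrow> 'k ut" where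
  "ut_of x = (coef (t11 x), coef (t12 x), coef (t22 x))"

lemma ut_of_mult: "ut_of (x * y) = utmul (ut_of x) (ut_of y)"
  by (simp add: ut_of_def utmul_def times_gr.rep_eq plus_gr.rep_eq)

lemma ut_word_ut_of: "ut_word (\<lambda>i. ut_of (\<phi> i)) w = ut_of (prod_list (map \<phi> w))"
  by (induction w)
    (simp_all add: ut_word_def ut_of_mult utone_def ut_of_def[of 1] one_gr.rep_eq zero_gr.rep_eq)

lemma ut_eval_ut_of: "ut_eval (\<lambda>i. ut_of (\<phi> i)) f = ut_of (peval \<phi> f)"
  unfolding ut_eval_def ut_word_ut_of by (simp add: ut_of_def peval_def fun_eq_iff)

lemma ut_of_eq_utzero: "ut_of x = utzero \<longleftrightarrow> x = 0"
  by (auto simp: ut_of_def utzero_def tri.expand zero_gr.rep_eq[symmetric] coef_inject)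

lemma T_ut_image:
  "T_ut (ut_of ` R) = {f \<in> free_alg. \<forall>\<phi>. (\<forall>i. \<phi> i \<in> R) \<longrightarrow> peval \<phi> f = 0}"
proof -
  have "(\<forall>phi. (\<forall>i. phi i \<in> ut_of ` R) \<longrightarrow> ut_eval phi f = utzero) \<longleftrightarrow>
      (\<forall>\<phi>. (\<forall>i. \<phi> i \<in> R) \<longrightarrow> peval \<phi> f = 0)" (is "?L \<longleftrightarrow> ?R") for f
  proof
    assume L: ?L
    show ?R
    proof (intro allI impI)
      fix \<phi> :: "nat \<Rightarrow> 'a gr tri" assume "\<forall>i. \<phi> i \<in> R"
      then show "peval \<phi> f = 0" using L[rule_format, of "\<lambda>i. ut_of (\<phi> i)"]
        by (simp add: ut_eval_ut_of ut_of_eq_utzero)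
    qed
  next
    assume R: ?R
    show ?L
    proof (intro allI impI)
      fix phi :: "nat \<Rightarrow> 'a ut" assume "\<forall>i. phi i \<in> ut_of ` R"
      then obtain \<phi> where \<phi>: "\<forall>i. phi i = ut_of (\<phi> i) \<and> \<phi> i \<in> R" unfolding image_iff by metis
      then have "phi = (\<lambda>i. ut_of (\<phi> i))" by auto
      then show "ut_eval phi f = utzero" using R \<phi> by (simp add: ut_eval_ut_of ut_of_eq_utzero)
    qed
  qed
  then show ?thesis unfolding T_ut_def by blast
qed

section \<open>Copies of the two concrete algebras inside the matrix ring\<close>

definition fin_gr :: "nat \<Rightarrow> 'k::comm_ring_1 gr set" where
  "fin_gr n = {x. \<forall>S. coef x S \<noteq> 0 \<longrightarrow> S \<subseteq> {1..n}}"

definition tri_over :: "'k::comm_ring_1 grass set \<Rightarrow> 'k gr tri set" where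
  "tri_over X = {x. coef (t11 x) \<in> X \<and> even_gr (t11 x) \<and> coef (t12 x) \<in> X \<and> coef (t22 x) \<in> X}"

lemma coef_in_grassmann_fin: "coef x \<in> grassmann_fin n \<longleftrightarrow> x \<in> fin_gr n"
proof
  assume x: "x \<in> fin_gr n"
  then have "{S. coef x S \<noteq> 0} \<subseteq> Pow {1..n}" by (auto simp: fin_gr_def)
  then have "finite {S. coef x S \<noteq> 0}" by (rule finite_subset) simp
  moreover have "finite S \<and> 0 \<notin> S" if "S \<subseteq> {1..n}" for S
    using finite_subset[OF that] that by auto
  ultimately show "coef x \<in> grassmann_fin n"
    using x by (auto simp: fin_gr_def grassmann_fin_def grassmann_def)
qed (auto simp: fin_gr_def grassmann_fin_def)

lemma UT_alg_image:
  fixes X :: "'k::comm_ring_1 grass set"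
  assumes "X \<subseteq> grassmann"
  shows "UT_alg (grass_even X) X = ut_of ` tri_over X"
proof (intro equalityI subsetI)
  fix p assume "p \<in> UT_alg (grass_even X) X"
  then obtain a b c where p: "p = (a, b, c)" "a \<in> grass_even X" "b \<in> X" "c \<in> X"
    by (auto simp: UT_alg_def)
  have coef: "coef (Gr x) = x" if "x \<in> X" for x
    using that assms by (subst Gr_inverse) (auto simp: grassmann_def)
  have "a \<in> X" and "\<forall>S. odd (card S) \<longrightarrow> a S = 0" using p by (auto simp: grass_even_def)
  then show "p \<in> ut_of ` tri_over X"
    using p by (intro image_eqI[of _ _ "Tri (Gr a) (Gr b) (Gr c)"])
      (auto simp: ut_of_def tri_over_def even_gr_def coef)
next
  fix p assume "p \<in> ut_of ` tri_over X"
  then show "p \<in> UT_alg (grass_even X) X"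
    by (auto simp: ut_of_def tri_over_def even_gr_def UT_alg_def grass_even_def)
qed

lemma A_alg_image: "A_alg = ut_of ` tri_over grassmann"
  by (simp add: A_alg_def UT_alg_image)

lemma A_fin_image: "A_fin n = ut_of ` tri_over (grassmann_fin n)"
  by (simp add: A_fin_def UT_alg_image grassmann_fin_def)

lemma scl_fin_gr: "scl c \<in> fin_gr n"
  by (simp add: fin_gr_def coef_scl)

lemma gen_fin_gr: "i \<in> {1..n} \<Longrightarrow> gen i \<in> fin_gr n"
  by (simp add: fin_gr_def coef_gen)

lemma zero_fin_gr: "0 \<in> fin_gr n"
  by (simp add: fin_gr_def)

lemma add_fin_gr: "x \<in> fin_gr n \<Longrightarrow> y \<in> fin_gr n \<Longrightarrow> x + y \<in> fin_gr n"
  unfolding fin_gr_def mem_Collect_eq coef_simps by (metis add.right_neutral)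

lemma coef_mult_nonzero:
  assumes "coef (x * y) U \<noteq> 0"
  obtains S where "S \<subseteq> U" "finite U" "coef x S \<noteq> 0" "coef y (U - S) \<noteq> 0"
proof -
  have fin: "finite U" using assms coef_infinite by blast
  then obtain S where "S \<in> Pow U" "gsign S (U - S) * coef x S * coef y (U - S) \<noteq> 0"
    using assms unfolding coef_mult[OF fin] by (meson sum.not_neutral_contains_not_neutral)
  moreover from this have "coef x S \<noteq> 0" "coef y (U - S) \<noteq> 0" by auto
  ultimately show ?thesis using that[of S] fin by auto
qed

lemma mult_fin_gr: "x \<in> fin_gr n \<Longrightarrow> y \<in> fin_gr n \<Longrightarrow> x * y \<in> fin_gr n"
  unfolding fin_gr_def by (auto elim!: coef_mult_nonzero)

lemma even_gr_mult:
  assumes "even_gr x" "even_gr y"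
  shows "even_gr (x * y)"
  unfolding even_gr_def
proof (intro allI impI, rule ccontr)
  fix U assume odd: "odd (card U)" and "coef (x * y) U \<noteq> 0"
  then obtain S where S: "S \<subseteq> U" "finite U" "coef x S \<noteq> 0" "coef y (U - S) \<noteq> 0"
    by (auto elim: coef_mult_nonzero)
  then have "even (card S)" "even (card (U - S))" using assms by (auto simp: even_gr_def)
  moreover have "card U = card S + card (U - S)"
    using S card_Diff_subset[of S U] card_mono[of U S] finite_subset[of S U] by simp
  ultimately show False using odd by simp
qed

lemma even_gr_add: "even_gr x \<Longrightarrow> even_gr y \<Longrightarrow> even_gr (x + y)"
  by (simp add: even_gr_def)

lemma even_gr_01: "even_gr 0" "even_gr 1"
  by (simp_all add: even_gr_def)

lemma mem_tri_fin:
  "x \<in> tri_over (grassmann_fin n) \<longleftrightarrow>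
     t11 x \<in> fin_gr n \<and> even_gr (t11 x) \<and> t12 x \<in> fin_gr n \<and> t22 x \<in> fin_gr n"
  by (simp add: tri_over_def coef_in_grassmann_fin)

text \<open>Needed to apply an identity of the finite-dimensional algebra to values of polynomials
  at generic matrices; for the upper left entry the point is that even elements form a
  subring.\<close>

lemma peval_tri_fin:
  assumes "\<And>i. \<phi> i \<in> tri_over (grassmann_fin n)"
  shows "peval \<phi> f \<in> tri_over (grassmann_fin n)"
proof -
  have one: "1 \<in> tri_over (grassmann_fin n)"
    using scl_fin_gr[of 1 n] by (simp add: mem_tri_fin zero_fin_gr even_gr_01)
  have zero: "0 \<in> tri_over (grassmann_fin n)"
    by (simp add: mem_tri_fin zero_fin_gr even_gr_01)
  have mult: "x * y \<in> tri_over (grassmann_fin n)"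
    if "x \<in> tri_over (grassmann_fin n)" "y \<in> tri_over (grassmann_fin n)" for x y :: "'a gr tri"
    using that by (simp add: mem_tri_fin mult_fin_gr add_fin_gr even_gr_mult)
  have add: "x + y \<in> tri_over (grassmann_fin n)"
    if "x \<in> tri_over (grassmann_fin n)" "y \<in> tri_over (grassmann_fin n)" for x y :: "'a gr tri"
    using that by (simp add: mem_tri_fin add_fin_gr even_gr_add)
  have "prod_list (map \<phi> w) \<in> tri_over (grassmann_fin n)" for w
    by (induction w) (auto simp: one mult assms)
  moreover have "tscl c \<in> tri_over (grassmann_fin n)" for c :: 'a
    by (simp add: mem_tri_fin scl_fin_gr zero_fin_gr even_gr_scl)
  ultimately have "tscl (f w) * prod_list (map \<phi> w) \<in> tri_over (grassmann_fin n)" for w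
    by (intro mult)
  then have "(\<Sum>w\<in>W. tscl (f w) * prod_list (map \<phi> w)) \<in> tri_over (grassmann_fin n)" for W
    by (induction W rule: infinite_finite_induct) (auto simp: zero add)
  then show ?thesis by (simp add: peval_def)
qed

subsection \<open>From scalar to even arguments\<close>

text \<open>A word product grows by one factor on the left, so it suffices that left multiplication
  by each entry preserves \<open>poly_fun\<close>. The upper right entry of a product also involves
  the lower right entry of the tail.\<close>

lemma poly_fun_peval:
  assumes "\<And>i F. poly_fun F \<Longrightarrow> poly_fun (\<lambda>z. t11 (\<phi> z i) * F z)"
    and "\<And>i F. poly_fun F \<Longrightarrow> poly_fun (\<lambda>z. t12 (\<phi> z i) * F z)"
    and "\<And>i F. poly_fun F \<Longrightarrow> poly_fun (\<lambda>z. t22 (\<phi> z i) * F z)"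
  shows "poly_fun (\<lambda>z. t11 (peval (\<phi> z) f))" "poly_fun (\<lambda>z. t12 (peval (\<phi> z) f))"
    "poly_fun (\<lambda>z. t22 (peval (\<phi> z) f))"
proof -
  have 1: "poly_fun (\<lambda>z. t11 (prod_list (map (\<phi> z) w)))" for w
    by (induction w) (auto intro: poly_fun_const assms)
  have 2: "poly_fun (\<lambda>z. t22 (prod_list (map (\<phi> z) w)))" for w
    by (induction w) (auto intro: poly_fun_const assms)
  have 3: "poly_fun (\<lambda>z. t12 (prod_list (map (\<phi> z) w)))" for w
    by (induction w) (auto intro!: poly_fun_const poly_fun_add assms 2)
  show "poly_fun (\<lambda>z. t11 (peval (\<phi> z) f))" "poly_fun (\<lambda>z. t12 (peval (\<phi> z) f))"
    "poly_fun (\<lambda>z. t22 (peval (\<phi> z) f))"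
    using 1 2 3 by (auto simp: peval_def intro!: poly_fun_sum poly_fun_const_mult)
qed

lemma peval_eq_0_if_scalars:
  fixes \<phi> :: "(nat \<Rightarrow> 'k::field_char_0 gr) \<Rightarrow> nat \<Rightarrow> 'k gr tri"
  assumes "\<And>i F. poly_fun F \<Longrightarrow> poly_fun (\<lambda>z. t11 (\<phi> z i) * F z)"
    and "\<And>i F. poly_fun F \<Longrightarrow> poly_fun (\<lambda>z. t12 (\<phi> z i) * F z)"
    and "\<And>i F. poly_fun F \<Longrightarrow> poly_fun (\<lambda>z. t22 (\<phi> z i) * F z)"
    and "\<And>x. peval (\<phi> (\<lambda>i. scl (x i))) f = 0" and z: "\<And>i. even_gr (z i)"
  shows "peval (\<phi> z) f = 0"
  using poly_fun_eq_0[OF poly_fun_peval(1)[of \<phi> f, OF assms(1-3)] _ z]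
    poly_fun_eq_0[OF poly_fun_peval(2)[of \<phi> f, OF assms(1-3)] _ z]
    poly_fun_eq_0[OF poly_fun_peval(3)[of \<phi> f, OF assms(1-3)] _ z] assms(4)
  by (simp add: tri.expand)

lemma peval_eq_0_even_t11:
  fixes a :: "nat \<Rightarrow> 'k::field_char_0 gr"
  assumes "\<And>x. peval (\<lambda>i. Tri (scl (x i)) (b i) (c i)) f = 0" "\<And>i. even_gr (a i)"
  shows "peval (\<lambda>i. Tri (a i) (b i) (c i)) f = 0"
  by (rule peval_eq_0_if_scalars[where \<phi> = "\<lambda>z i. Tri (z i) (b i) (c i)"])
    (auto intro: poly_fun_const_mult poly_fun_var_mult assms)

lemma peval_eq_0_even_t22:
  fixes v :: "nat \<Rightarrow> 'k::field_char_0 gr"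
  assumes "\<And>x. peval (\<lambda>i. Tri (a i) (b i) (scl (x i) + u i)) f = 0" "\<And>i. even_gr (v i)"
  shows "peval (\<lambda>i. Tri (a i) (b i) (v i + u i)) f = 0"
  by (rule peval_eq_0_if_scalars[where \<phi> = "\<lambda>z i. Tri (a i) (b i) (z i + u i)"])
    (auto simp: distrib_right intro: poly_fun_const_mult poly_fun_var_mult poly_fun_add assms)

subsection \<open>Specialising the odd generators\<close>

text \<open>This is the substitution of \<open>u i\<close> for the generators, written in the basis
  of the algebra on \<open>e_1, ..., e_n\<close>; coefficients at other sets are dropped.\<close>

definition spec_gr :: "nat \<Rightarrow> (nat \<Rightarrow> 'k::comm_ring_1 gr) \<Rightarrow> 'k gr \<Rightarrow> 'k gr" where
  "spec_gr n u x = (\<Sum>S\<in>Pow {1..n}. scl (coef x S) * ordered_prod u S)"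

lemma spec_gr_add: "spec_gr n u (x + y) = spec_gr n u x + spec_gr n u y"
  by (simp add: spec_gr_def distrib_right sum.distrib)

lemma spec_gr_zero: "spec_gr n u 0 = 0"
  by (simp add: spec_gr_def)

lemma spec_gr_sum: "spec_gr n u (sum f I) = (\<Sum>i\<in>I. spec_gr n u (f i))"
  by (induction I rule: infinite_finite_induct) (auto simp: spec_gr_add spec_gr_zero)

lemma spec_gr_scl_mult: "spec_gr n u (scl c * x) = scl c * spec_gr n u x"
  by (simp add: spec_gr_def sum_distrib_left mult.assoc)

lemma spec_gr_one: "spec_gr n u 1 = 1"
proof -
  have "spec_gr n u 1 = (\<Sum>S\<in>Pow {1..n}. if S = {} then 1 else 0)"
    unfolding spec_gr_def by (rule sum.cong) (auto simp: ordered_prod_def)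
  then show ?thesis by simp
qed

text \<open>Sets with \<open>i\<close> correspond to sets without \<open>i\<close> by removing it.
  Terms of \<open>x\<close> whose set contains \<open>i\<close> vanish on both sides, and the
  remaining signs agree by \<open>mult_ordered_prod\<close>.\<close>

lemma spec_gr_gen_mult:
  fixes u :: "nat \<Rightarrow> 'k::field_char_0 gr"
  assumes "\<And>i. odd_gr (u i)" "i \<in> {1..n}"
  shows "spec_gr n u (gen i * x) = u i * spec_gr n u x"
proof -
  have fin: "finite S" if "S \<subseteq> {1..n}" for S using finite_subset[OF that] by simp
  let ?g = "\<lambda>T. scl (coef x T * gsign {i} T) * ordered_prod u (insert i T)"
  have "spec_gr n u (gen i * x) = (\<Sum>S\<in>{S \<in> Pow {1..n}. i \<in> S}. ?g (S - {i}))"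
    unfolding spec_gr_def
    by (rule sum.mono_neutral_cong_right)
      (use fin in \<open>auto simp: coef_gen_mult insert_absorb mult.commute[of "gsign _ _"] simp del: scl_simps(4)\<close>)
  also have "\<dots> = (\<Sum>T\<in>{T \<in> Pow {1..n}. i \<notin> T}. ?g T)"
    by (rule sum.reindex_bij_witness[of _ "insert i" "\<lambda>S. S - {i}"]) (use assms(2) in auto)
  also have "\<dots> = (\<Sum>T\<in>Pow {1..n}. scl (coef x T) * (u i * ordered_prod u T))"
    by (rule sum.mono_neutral_cong_left)
      (use fin in \<open>auto simp: mult_ordered_prod[of u, OF assms(1)] mult.assoc\<close>)
  also have "\<dots> = u i * spec_gr n u x"
    unfolding spec_gr_def sum_distrib_left
    by (rule sum.cong) (simp_all add: scl_commute[of "u i"] flip: mult.assoc)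
  finally show ?thesis .
qed

text \<open>The matrix entries are scalars, possibly plus a generator, so compatibility of
  \<open>spec_gr\<close> with left multiplication by these is enough for an induction on
  words.\<close>

lemma spec_gr_peval:
  fixes u :: "nat \<Rightarrow> 'k::field_char_0 gr"
  assumes "\<And>i. odd_gr (u i)" and u0: "\<And>i. i \<notin> {1..n} \<Longrightarrow> u i = 0"
  defines "e \<equiv> (\<lambda>i. if i \<in> {1..n} then gen i else 0)"
  shows "peval (\<lambda>i. Tri (scl (s i)) (scl (y i)) (scl (t i) + u i)) h =
    map_tri (spec_gr n u) (peval (\<lambda>i. Tri (scl (s i)) (scl (y i)) (scl (t i) + e i)) h)"
proof -
  let ?U = "\<lambda>i. Tri (scl (s i)) (scl (y i)) (scl (t i) + u i)"
    and ?E = "\<lambda>i. Tri (scl (s i)) (scl (y i)) (scl (t i) + e i)"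
  have e: "spec_gr n u (e i * x) = u i * spec_gr n u x" for i x
    using spec_gr_gen_mult[OF assms(1), where i = i and n = n and x = x] u0[of i] by (simp add: e_def spec_gr_zero del: atLeastAtMost_iff)
  note spec = e spec_gr_add spec_gr_zero spec_gr_one spec_gr_scl_mult distrib_right
  have "prod_list (map ?U w) = map_tri (spec_gr n u) (prod_list (map ?E w))" for w
    by (induction w) (auto simp: tri.expand tri.map_sel spec)
  then show ?thesis
    by (auto simp: peval_def tri.expand tri.map_sel spec_gr_sum spec intro!: sum.cong)
qed

text \<open>The upper right entry of a word is a sum over positions, each term carrying exactly one
  \<open>b i\<close>. The factors to its left are scalars, so \<open>b i\<close> can be pulled to
  the front and the terms collected by letter.\<close>

lemma t12_prod_list_linear:
  fixes b :: "nat \<Rightarrow> 'k::comm_ring_1 gr"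
  assumes "finite J" "set w \<subseteq> J"
  shows "t12 (prod_list (map (\<lambda>i. Tri (scl (s i)) (b i) (c i)) w)) =
    (\<Sum>j\<in>J. b j * t12 (prod_list (map (\<lambda>i. Tri (scl (s i)) (scl (if i = j then 1 else 0)) (c i)) w)))"
  using assms(2)
proof (induction w)
  case (Cons i w)
  let ?m = "\<lambda>j. t12 (prod_list (map (\<lambda>i. Tri (scl (s i)) (scl (if i = j then 1 else 0)) (c i)) w))"
  have t22: "t22 (prod_list (map (\<lambda>i. Tri (scl (s i)) (b' i) (c i)) w)) = prod_list (map c w)" for b'
    by (induction w) auto
  have "(\<Sum>j\<in>J. b j * (scl (s i) * ?m j + scl (if i = j then 1 else 0) * prod_list (map c w))) =
      scl (s i) * (\<Sum>j\<in>J. b j * ?m j) + (\<Sum>j\<in>J. if i = j then b i * prod_list (map c w) else 0)"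
    unfolding sum_distrib_left sum.distrib[symmetric]
    by (rule sum.cong) (auto simp: distrib_left scl_commute[of "b _"] simp flip: mult.assoc)
  then show ?case using Cons assms(1) by (simp add: t22)
qed simp

lemma peval_eq_0_t12:
  fixes b :: "nat \<Rightarrow> 'k::comm_ring_1 gr"
  assumes "h \<in> free_alg_n n" "\<And>y. peval (\<lambda>i. Tri (scl (s i)) (scl (y i)) (c i)) h = 0"
  shows "peval (\<lambda>i. Tri (scl (s i)) (b i) (c i)) h = 0"
proof -
  let ?D = "\<lambda>j i. Tri (scl (s i)) (scl (if i = j then 1 else 0)) (c i)"
  let ?B = "\<lambda>i. Tri (scl (s i)) (b i) (c i)"
  \<comment> \<open>Diagonal entries do not depend on the upper right corner, so one instance of the
    hypothesis, here with \<open>j = 0\<close>, gives their vanishing.\<close>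
  have diag: "t11 (prod_list (map ?B w)) = t11 (prod_list (map (?D 0) w))"
    "t22 (prod_list (map ?B w)) = t22 (prod_list (map (?D 0) w))" for w
    by (induction w) auto
  have "t12 (peval ?B h) =
      (\<Sum>w | h w \<noteq> 0. \<Sum>j\<in>{1..n}. b j * (scl (h w) * t12 (prod_list (map (?D j) w))))"
    unfolding peval_def using assms(1) t12_prod_list_linear[of "{1..n}" _ s b c]
    by (auto simp: free_alg_n_def sum_distrib_left scl_commute[of "b _"] simp flip: mult.assoc
        intro!: sum.cong)
  also have "\<dots> = (\<Sum>j\<in>{1..n}. b j * t12 (peval (?D j) h))"
    by (subst sum.swap) (simp add: peval_def sum_distrib_left)
  also have "\<dots> = 0" using assms(2) by simp
  finally have "t12 (peval ?B h) = 0" .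
  moreover have "t11 (peval ?B h) = t11 (peval (?D 0) h)" "t22 (peval ?B h) = t22 (peval (?D 0) h)"
    by (simp_all add: peval_def diag)
  ultimately show ?thesis using assms(2)[of "\<lambda>i. if i = 0 then 1 else 0"] by (simp add: tri.expand)
qed

text \<open>The entries are generalised one kind at a time: first the odd part of the lower right
  entry, by specialisation while all else is scalar; then the upper right entry, by linearity while
  the upper left one is scalar; finally the even parts on the diagonal.\<close>

lemma peval_eq_0_if_generic:
  fixes \<phi> :: "nat \<Rightarrow> 'k::field_char_0 gr tri"
  assumes h: "h \<in> free_alg_n n"
    and h0: "\<And>s y t. peval (\<lambda>i. Tri (scl (s i)) (scl (y i))
      (scl (t i) + (if i \<in> {1..n} then gen i else 0))) h = 0"
    and even: "\<And>i. even_gr (t11 (\<phi> i))"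
  shows "peval \<phi> h = 0"
proof -
  have "\<exists>v u. even_gr v \<and> odd_gr u \<and> t22 (\<phi> i) = v + u" for i
    by (rule even_odd_decomp[of "t22 (\<phi> i)"]) blast
  then obtain v u where vu: "\<And>i. even_gr (v i)" "\<And>i. odd_gr (u i)" "\<And>i. t22 (\<phi> i) = v i + u i"
    by metis
  \<comment> \<open>Specialisation asks for 0 outside \<open>{1..n}\<close>. Letters outside this
    range do not occur in \<open>h\<close>, so \<open>peval_cong\<close> restores the original
    matrices at the end.\<close>
  define u' where "u' i = (if i \<in> {1..n} then u i else 0)" for i
  have u': "odd_gr (u' i)" "i \<notin> {1..n} \<Longrightarrow> u' i = 0" for i
    using vu(2)[of i] by (auto simp: u'_def odd_gr_def)
  have "peval (\<lambda>i. Tri (scl (s i)) (scl (y i)) (scl (t i) + u' i)) h = 0" for s y t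
    using spec_gr_peval[of u' n s y t h] u' h0[of s y t] by (simp add: tri.expand tri.map_sel spec_gr_zero)
  then have "peval (\<lambda>i. Tri (scl (s i)) (t12 (\<phi> i)) (scl (t i) + u' i)) h = 0" for s t
    by (rule peval_eq_0_t12[OF h])
  then have "peval (\<lambda>i. Tri (scl (s i)) (t12 (\<phi> i)) (v i + u' i)) h = 0" for s
    by (rule peval_eq_0_even_t22) (rule vu)
  then have "peval (\<lambda>i. Tri (t11 (\<phi> i)) (t12 (\<phi> i)) (v i + u' i)) h = 0"
    by (rule peval_eq_0_even_t11) (rule even)
  moreover have "peval \<phi> h = peval (\<lambda>i. Tri (t11 (\<phi> i)) (t12 (\<phi> i)) (v i + u' i)) h"
  proof (rule peval_cong)
    fix w i assume "h w \<noteq> 0" "i \<in> set w"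
    then have "i \<in> {1..n}" using h unfolding free_alg_n_def by blast
    then show "\<phi> i = Tri (t11 (\<phi> i)) (t12 (\<phi> i)) (v i + u' i)" by (simp add: tri.expand vu(3) u'_def)
  qed
  ultimately show ?thesis by simp
qed

section \<open>The inclusion of T(A^(n)) in T(F_n(A))\<close>

lemma T_A_fin_subset_T_Fn: "T_ut (A_fin n) \<subseteq> (T_Fn n :: 'k::field_char_0 ncpoly set)"
proof
  fix f :: "'k ncpoly" assume "f \<in> T_ut (A_fin n)"
  then have f: "f \<in> free_alg"
    and f0: "\<And>\<phi>. (\<And>i. \<phi> i \<in> tri_over (grassmann_fin n)) \<Longrightarrow> peval \<phi> f = 0"
    by (auto simp: A_fin_image T_ut_image)
  have "psubst g f \<in> T_ut A_alg" if g: "\<And>i. g i \<in> free_alg_n n" for g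
  proof -
    have h: "psubst g f \<in> free_alg_n n" by (rule free_alg_n_psubst[OF f g])
    have "peval \<phi> (psubst g f) = 0" if "\<And>i. even_gr (t11 (\<phi> i))" for \<phi>
    proof (rule peval_eq_0_if_generic[OF h _ that])
      fix s y t :: "nat \<Rightarrow> 'k"
      \<comment> \<open>The generic matrices lie in A^(n), hence so do the values of the
        \<open>g i\<close> at them, and \<open>f\<close> vanishes at those values.\<close>
      show "peval (\<lambda>i. Tri (scl (s i)) (scl (y i))
          (scl (t i) + (if i \<in> {1..n} then gen i else 0))) (psubst g f) = 0"
        unfolding peval_psubst[OF f g]
        by (intro f0 peval_tri_fin)
          (auto simp: mem_tri_fin scl_fin_gr even_gr_scl gen_fin_gr zero_fin_gr intro!: add_fin_gr)
    qed
    then show ?thesis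
      unfolding A_alg_image T_ut_image using free_alg_n_subset[OF h] by (auto simp: tri_over_def)
  qed
  then show "f \<in> T_Fn n" using f by (simp add: T_Fn_def)
qed

subsection \<open>Generation by \<open>n\<close> elements\<close>

text \<open>The unital subalgebra generated by \<open>\<phi> 1, ..., \<phi> n\<close>, encoded as an
  image so that each member comes with a polynomial in n variables producing it.\<close>

definition generated :: "nat \<Rightarrow> (nat \<Rightarrow> 'k::comm_ring_1 gr tri) \<Rightarrow> 'k gr tri set" where
  "generated n \<phi> = peval \<phi> ` free_alg_n n"

lemma generated_one: "1 \<in> generated n \<phi>"
  unfolding generated_def using free_alg_n_pone peval_pone by (metis image_eqI)

lemma generated_mult: "x \<in> generated n \<phi> \<Longrightarrow> y \<in> generated n \<phi> \<Longrightarrow> x * y \<in> generated n \<phi>"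
  unfolding generated_def by (auto simp flip: peval_pmul[OF free_alg_n_subset free_alg_n_subset]
      intro!: imageI free_alg_n_pmul)

lemma generated_sum:
  assumes "finite I" "\<And>i. i \<in> I \<Longrightarrow> x i \<in> generated n \<phi>"
  shows "(\<Sum>i\<in>I. tscl (c i) * x i) \<in> generated n \<phi>"
proof -
  have "\<forall>i\<in>I. \<exists>p. p \<in> free_alg_n n \<and> x i = peval \<phi> p"
    using assms(2) unfolding generated_def by blast
  then obtain p where p: "\<And>i. i \<in> I \<Longrightarrow> p i \<in> free_alg_n n" "\<And>i. i \<in> I \<Longrightarrow> x i = peval \<phi> (p i)"
    by metis
  have "(\<Sum>i\<in>I. tscl (c i) * x i) = peval \<phi> (\<lambda>w. \<Sum>i\<in>I. c i * p i w)"
    using assms(1) p free_alg_n_subset by (subst peval_lincomb) (auto intro!: sum.cong)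
  then show ?thesis unfolding generated_def using free_alg_n_lincomb[of I p n c, OF assms(1) p(1)] by auto
qed

lemma generated_scl: "x \<in> generated n \<phi> \<Longrightarrow> tscl c * x \<in> generated n \<phi>"
  using generated_sum[of "{()}" "\<lambda>_. x" n \<phi> "\<lambda>_. c"] by simp

lemma generated_add: "x \<in> generated n \<phi> \<Longrightarrow> y \<in> generated n \<phi> \<Longrightarrow> x + y \<in> generated n \<phi>"
  using generated_sum[of UNIV "\<lambda>b. if b then x else y" n \<phi> "\<lambda>_. 1"] by (simp add: UNIV_bool add.commute)

lemma generated_diff:
  fixes x y :: "'k::comm_ring_1 gr tri"
  assumes "x \<in> generated n \<phi>" "y \<in> generated n \<phi>"
  shows "x - y \<in> generated n \<phi>"
proof -
  have "tscl (- 1) = - (1 :: 'k gr tri)"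
    using tscl_simps(3)[of "-1" "1::'k"] by (simp add: eq_neg_iff_add_eq_0 del: tscl_simps(3))
  then show ?thesis
    using generated_add[OF assms(1) generated_scl[OF assms(2), of "- 1"]] by simp
qed

lemma generated_var:
  assumes "i \<in> {1..n}"
  shows "\<phi> i \<in> generated n \<phi>"
proof -
  define p :: "'a ncpoly" where "p = (\<lambda>w. if w = [i] then 1 else 0)"
  have "p \<in> free_alg_n n"
    using assms by (auto simp: p_def free_alg_n_def free_alg_def)
  moreover have "peval \<phi> p = \<phi> i"
    by (subst peval_superset[of "{[i]}"]) (auto simp: p_def split: if_splits)
  ultimately show ?thesis unfolding generated_def by (metis image_eqI)
qed

text \<open>Only n matrices are available, yet they must yield n odd generators, an idempotent and a
  matrix unit. So the idempotent is merged with \<open>e_1\<close> and the matrix unit with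
  \<open>e_2\<close>.\<close>

definition gens :: "nat \<Rightarrow> 'k::comm_ring_1 gr tri" where
  "gens i = (if i = 0 then 0 else if i = 1 then Tri 0 0 (1 + gen 1)
     else Tri 0 (if i = 2 then 1 else 0) (gen i))"

lemma gens_in_A: "(gens i :: 'k::comm_ring_1 gr tri) \<in> tri_over grassmann"
proof -
  have "coef (0 :: 'k gr) \<in> grassmann" "coef (1 :: 'k gr) \<in> grassmann"
    "i \<noteq> 0 \<Longrightarrow> coef (gen i :: 'k gr) \<in> grassmann" "coef (1 + gen (Suc 0) :: 'k gr) \<in> grassmann"
    by (auto simp: grassmann_def coef_gen intro: finite_subset[of _ "{{}, {Suc 0}}"])
  then show ?thesis by (simp add: gens_def tri_over_def even_gr_01)
qed

text \<open>With \<open>u = 2 X\<^sub>1 - X\<^sub>1\<^sup>2 = Tri 0 0 1\<close>, the commutator of \<open>X\<^sub>2\<close> and \<open>u\<close> is the matrix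
  unit \<open>Tri 0 1 0\<close>.\<close>
lemma generated_gens:
  fixes r :: "'k::field_char_0 gr"
  assumes n: "n \<ge> 2" and q: "q \<in> fin_gr n" and r: "r \<in> fin_gr n"
  shows "Tri (scl p) q r \<in> generated n gens"
proof -
  note gen_intros = generated_one generated_mult generated_add generated_diff generated_scl
  \<comment> \<open>Hence \<open>1 + e_1\<close> has square \<open>1 + 2 e_1\<close>, and twice
    \<open>1 + e_1\<close> minus this square is 1.\<close>
  have e1: "gen 1 * gen 1 = (0 :: 'k gr)"
    by (rule odd_gr_square) (auto simp: odd_gr_def coef_gen)
  have X: "gens i \<in> generated n gens" if "i \<in> {1..n}" for i using that by (rule generated_var)
  have X1: "gens 1 = Tri 0 0 (1 + gen 1)" and X2: "gens 2 = Tri 0 1 (gen 2)" by (simp_all add: gens_def)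
  have "Tri 0 0 1 = gens 1 + gens 1 - gens 1 * (gens 1 :: 'k gr tri)"
    unfolding X1 using e1 by (simp add: tri.expand algebra_simps)
  then have u: "Tri 0 0 1 \<in> generated n (gens :: nat \<Rightarrow> 'k gr tri)"
    using X[of 1] n by (auto intro: gen_intros)
  \<comment> \<open>Subtracting the idempotent frees \<open>e_1\<close>; multiplying by it from the
    left removes the upper row and frees \<open>e_2\<close>.\<close>
  have e: "Tri 0 0 (gen i) \<in> generated n (gens :: nat \<Rightarrow> 'k gr tri)" if i: "i \<in> {1..n}" for i
  proof -
    consider "i = 1" | "i = 2" | "i > 2" using i by fastforce
    then show ?thesis
    proof cases
      case 1
      have "Tri 0 0 (gen 1) = gens 1 - (Tri 0 0 1 :: 'k gr tri)" unfolding X1 by (simp add: tri.expand)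
      then show ?thesis using 1 X[of 1] i u by (auto intro: gen_intros)
    next
      case 2
      have "Tri 0 0 (gen 2) = Tri 0 0 1 * (gens 2 :: 'k gr tri)" by (simp add: X2 tri.expand)
      then show ?thesis using 2 X[of 2] i u by (auto intro: gen_intros)
    next
      case 3
      then show ?thesis using X[OF i] by (simp add: gens_def)
    qed
  qed
  have "Tri 0 1 0 = gens 2 * Tri 0 0 1 - Tri 0 0 1 * (gens 2 :: 'k gr tri)" by (simp add: X2 tri.expand)
  then have m: "Tri 0 1 0 \<in> generated n (gens :: nat \<Rightarrow> 'k gr tri)"
    using X[of 2] u n by (auto intro: gen_intros)
  have eS: "Tri 0 0 (ordered_prod gen S) \<in> generated n (gens :: nat \<Rightarrow> 'k gr tri)"
    if "S \<subseteq> {1..n}" for S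
    using finite_subset[OF that finite_atLeastAtMost] that
  proof (induction S rule: finite_linorder_min_induct)
    case empty
    then show ?case using u by (simp add: ordered_prod_def)
  next
    case (insert b A)
    have "Tri 0 0 (ordered_prod gen (insert b A)) =
        Tri 0 0 (gen b) * (Tri 0 0 (ordered_prod gen A) :: 'k gr tri)"
      using insert.hyps by (simp add: ordered_prod_insert_min tri.expand)
    then show ?case using insert e[of b] by (simp add: generated_mult)
  qed
  have corner: "Tri 0 0 x \<in> generated n gens" if x: "x \<in> fin_gr n" for x :: "'k gr"
  proof -
    have "x = (\<Sum>S\<in>Pow {1..n}. scl (coef x S) * ordered_prod gen S)"
    proof (rule gr_eqI)
      fix U :: "nat set"
      have "coef (\<Sum>S\<in>Pow {1..n}. scl (coef x S) * ordered_prod gen S) U =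
          (\<Sum>S\<in>Pow {1..n}. if U = S then coef x U else 0)"
        unfolding coef_sum by (rule sum.cong) (auto simp: coef_ordered_prod_gen finite_subset)
      then show "coef x U = coef (\<Sum>S\<in>Pow {1..n}. scl (coef x S) * ordered_prod gen S) U"
        using x by (auto simp: fin_gr_def)
    qed
    then have "Tri 0 0 x = (\<Sum>S\<in>Pow {1..n}. tscl (coef x S) * Tri 0 0 (ordered_prod gen S))"
      by (simp add: tri.expand)
    also have "\<dots> \<in> generated n gens"
      by (rule generated_sum) (auto intro!: eS)
    finally show ?thesis .
  qed
  \<comment> \<open>\<open>1 - Tri 0 0 1\<close> is the upper left idempotent, and left
    multiplication by \<open>Tri 0 1 0\<close> moves \<open>q\<close> from the lower right corner to
    the upper right one.\<close>
  have "Tri (scl p) q r = tscl p * (1 - Tri 0 0 1) + Tri 0 1 0 * Tri 0 0 q + Tri 0 0 r"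
    by (simp add: tri.expand)
  then show ?thesis using u m corner q r by (auto intro!: gen_intros)
qed

text \<open>Matrices with scalar upper left entry and the other entries in \<open>fin_gr n\<close>
  are values of polynomials \<open>g i\<close> at \<open>gens\<close>. So \<open>f\<close> at them
  is the value of \<open>psubst g f\<close> at a substitution from \<open>A\<close>, which is 0;
  even upper left entries follow by the polynomial argument.\<close>

lemma T_Fn_subset_T_A_fin:
  assumes "n \<ge> 2"
  shows "(T_Fn n :: 'k::field_char_0 ncpoly set) \<subseteq> T_ut (A_fin n)"
proof
  fix f :: "'k ncpoly" assume "f \<in> T_Fn n"
  then have f: "f \<in> free_alg"
    and fg: "\<And>g. (\<And>i. g i \<in> free_alg_n n) \<Longrightarrow> psubst g f \<in> T_ut A_alg"
    by (auto simp: T_Fn_def)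
  have scalar: "peval (\<lambda>i. Tri (scl (x i)) (q i) (r i)) f = 0"
    if qr: "\<And>i. q i \<in> fin_gr n" "\<And>i. r i \<in> fin_gr n" for x q r
  proof -
    have "\<forall>i. \<exists>g. g \<in> free_alg_n n \<and> Tri (scl (x i)) (q i) (r i) = peval gens g"
      using generated_gens[OF assms qr] unfolding generated_def image_iff Bex_def by blast
    from choice[OF this] obtain g where g: "\<And>i. g i \<in> free_alg_n n"
      "\<And>i. Tri (scl (x i)) (q i) (r i) = peval gens (g i)"
      by blast
    have "\<forall>\<phi>. (\<forall>i. \<phi> i \<in> tri_over grassmann) \<longrightarrow> peval \<phi> (psubst g f) = 0"
      using fg[of g, OF g(1)] by (simp add: A_alg_image T_ut_image)
    then have "peval gens (psubst g f) = 0" by (rule allE[of _ gens]) (simp add: gens_in_A)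
    then show ?thesis unfolding peval_psubst[OF f g(1)] g(2) .
  qed
  have "peval \<phi> f = 0" if \<phi>: "\<And>i. \<phi> i \<in> tri_over (grassmann_fin n)" for \<phi>
  proof -
    have "peval (\<lambda>i. Tri (t11 (\<phi> i)) (t12 (\<phi> i)) (t22 (\<phi> i))) f = 0"
    proof (rule peval_eq_0_even_t11)
      show "peval (\<lambda>i. Tri (scl (x i)) (t12 (\<phi> i)) (t22 (\<phi> i))) f = 0" for x
        by (rule scalar) (use \<phi> in \<open>auto simp: mem_tri_fin\<close>)
      show "even_gr (t11 (\<phi> i))" for i using \<phi> by (auto simp: mem_tri_fin)
    qed
    then show ?thesis by simp
  qed
  then show "f \<in> T_ut (A_fin n)" using f by (simp add: A_fin_image T_ut_image)
qed

theorem theorem3p10: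
  fixes n :: nat
  assumes "n \<ge> 2" and "even n"
  shows "(T_Fn n :: 'k::field_char_0 ncpoly set) = T_ut (A_fin n)"
  using T_Fn_subset_T_A_fin[OF assms(1)] T_A_fin_subset_T_Fn by blast

end
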